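(* Let $\mathcal N$ be a feed-forward ReLU network, $D$ a compact input domain and $\mathrm{Safety}$ a safety predicate. Assume that the verifier explores a finite partition tree of $D$: the root is $D$, each internal node is a region partitioned into its children, and the leaves are regions $R_\ell$. Suppose that for each leaf region $R_\ell$, with a sound linear store $C_\ell$, the verifier stores either (1) a dual-bound certificate proving that $\mathrm{Safety}$ holds on $R_\ell$, or (2) a Farkas certificate proving infeasibility of the counterexample query on $R_\ell$. Then the conjunction of the leaf certificates together with the split annotations implies $\mathrm{Safety}(\mathcal N(x))$ for all $x\in D$.
   Context: Network: $z^{(0)}=x$, $s^{(i)}=W^{(i)}z^{(i-1)}+b^{(i)}$, $z^{(i)}=\sigma(s^{(i)})$ for $i=1,\dots,L$, with $\sigma$ ReLU on hidden layers and identity on the output layer; $\mathcal N(x)=z^{(L)}$. The vector $v\in\mathbb R^N$ collects all network variables. For $R\subseteq D$, $\mathrm{Exact}(R)$ is the set of all $v$ satisfying the network equations exactly with $x\in R$. A linear store $C$ is a finite system of rational inequalities $Av\le b$, with feasible set $\mathrm{Feas}(C)$; it is sound for $R$ if $\mathrm{Exact}(R)\subseteq\mathrm{Feas}(C)$. $\neg\mathrm{Safety}$ is encoded exactly by a finite system $\Phi_{\neg P}$ of linear constraints on $z^{(L)}$. Dual bound certificate for the claim $g^\top v\le\beta$ over $Av\le b$: a rational $\lambda\ge0$ with $\lambda^\top A=g^\top$ and $\lambda^\top b\le\beta$. A dual-bound certificate that $\mathrm{Safety}$ holds on $R_\ell$ is a dual bound certificate over $C_\ell$ for $m(v)\ge0$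 (i.e. for $-q^\top v\le c$ where $m(v)=q^\top v+c$), where $m$ is a linear safety margin: $m(v)\ge0$ implies $\mathrm{Safety}$. Farkas certificate for infeasibility of $Av\le b$: a rational $\lambda\ge0$ with $\lambda^\top A=0^\top$ and $\lambda^\top b<0$. A Farkas certificate of infeasibility of the counterexample query on $R_\ell$ is a Farkas certificate for the linear system $C_\ell\cup\Phi_{\neg P}$. *)

theory Defs
  imports
    "HOL-Analysis.Abstract_Euclidean_Space"
    "HOL-Library.Disjoint_Sets"
    "Jordan_Normal_Form.Matrix"
begin

section \<open>Feed-forward ReLU networks\<close>

text \<open>Layers are numbered from 1 to the depth; index 0 is the input, so the values of
  \<open>weight\<close> and \<open>bias\<close> at 0 are irrelevant.\<close>

record network =
  depth :: nat
  width :: "nat \<Rightarrow> nat"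
  weight :: "nat \<Rightarrow> real mat"
  bias :: "nat \<Rightarrow> real vec"

definition feedforward :: "network \<Rightarrow> bool" where
  "feedforward net \<longleftrightarrow> 1 \<le> depth net \<and>
     (\<forall>i\<in>{1..depth net}.
        weight net i \<in> carrier_mat (width net i) (width net (i - 1)) \<and>
        bias net i \<in> carrier_vec (width net i))"

definition relu :: "real \<Rightarrow> real" where
  "relu t = max 0 t"

definition activation :: "network \<Rightarrow> nat \<Rightarrow> real vec \<Rightarrow> real vec" where
  "activation net i s = (if i < depth net then map_vec relu s else s)"

primrec layer_value :: "network \<Rightarrow> real vec \<Rightarrow> nat \<Rightarrow> real vec" where
  "layer_value net x 0 = x"
| "layer_value net x (Suc i) =
     activation net (Suc i) (weight net (Suc i) *\<^sub>v layer_value net x i + bias net (Suc i))"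

definition net_eval :: "network \<Rightarrow> real vec \<Rightarrow> real vec" where
  "net_eval net x = layer_value net x (depth net)"

text \<open>The type \<open>real vec\<close> carries no topology, so compactness of a set of \<open>n\<close>-vectors is taken
  in the library's Euclidean space of real sequences vanishing from index \<open>n\<close> on.\<close>

definition compact_domain :: "nat \<Rightarrow> real vec set \<Rightarrow> bool" where
  "compact_domain n D \<longleftrightarrow> D \<subseteq> carrier_vec n \<and>
     compactin (Euclidean_space n) ((\<lambda>x i. if i < n then x $ i else 0) ` D)"


section \<open>Network variables\<close>

text \<open>A vector of network variables is laid out in consecutive blocks
  \<open>z\<^sup>0, s\<^sup>1, z\<^sup>1, s\<^sup>2, z\<^sup>2, \<dots>, s\<^sup>L, z\<^sup>L\<close>.\<close>

definition s_offset :: "network \<Rightarrow> nat \<Rightarrow> nat" where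
  "s_offset net i = width net 0 + (\<Sum>j\<in>{1..<i}. 2 * width net j)"

definition z_offset :: "network \<Rightarrow> nat \<Rightarrow> nat" where
  "z_offset net i = (if i = 0 then 0 else s_offset net i + width net i)"

definition num_vars :: "network \<Rightarrow> nat" where
  "num_vars net = width net 0 + (\<Sum>j\<in>{1..depth net}. 2 * width net j)"

definition s_block :: "network \<Rightarrow> nat \<Rightarrow> real vec \<Rightarrow> real vec" where
  "s_block net i v = vec (width net i) (\<lambda>k. v $ (s_offset net i + k))"

definition z_block :: "network \<Rightarrow> nat \<Rightarrow> real vec \<Rightarrow> real vec" where
  "z_block net i v = vec (width net i) (\<lambda>k. v $ (z_offset net i + k))"

definition Exact :: "network \<Rightarrow> real vec set \<Rightarrow> real vec set" where
  "Exact net R = {v \<in> carrier_vec (num_vars net).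
     z_block net 0 v \<in> R \<and>
     (\<forall>i\<in>{1..depth net}.
        s_block net i v = weight net i *\<^sub>v z_block net (i - 1) v + bias net i \<and>
        z_block net i v = activation net i (s_block net i v))}"


section \<open>Linear systems and certificates\<close>

text \<open>A pair \<open>(A, b)\<close> stands for the system \<open>A v \<le> b\<close>. The order on vectors is componentwise.\<close>

type_synonym 'a lin_system = "'a mat \<times> 'a vec"

definition is_system :: "nat \<Rightarrow> 'a lin_system \<Rightarrow> bool" where
  "is_system n S \<longleftrightarrow> fst S \<in> carrier_mat (dim_vec (snd S)) n"

definition Feas :: "nat \<Rightarrow> real lin_system \<Rightarrow> real vec set" where
  "Feas n S = {v \<in> carrier_vec n. fst S *\<^sub>v v \<le> snd S}"

definition real_system :: "rat lin_system \<Rightarrow> real lin_system" where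
  "real_system C = (map_mat of_rat (fst C), map_vec of_rat (snd C))"

definition union_system :: "'a::zero lin_system \<Rightarrow> 'a lin_system \<Rightarrow> 'a lin_system" where
  "union_system S T = (fst S @\<^sub>r fst T, snd S @\<^sub>v snd T)"

definition dual_bound_certificate ::
    "real lin_system \<Rightarrow> real vec \<Rightarrow> real \<Rightarrow> rat vec \<Rightarrow> bool" where
  "dual_bound_certificate S g \<beta> lam \<longleftrightarrow>
     lam \<in> carrier_vec (dim_vec (snd S)) \<and>
     0\<^sub>v (dim_vec (snd S)) \<le> lam \<and>
     transpose_mat (fst S) *\<^sub>v map_vec of_rat lam = g \<and>
     map_vec of_rat lam \<bullet> snd S \<le> \<beta>"

definition farkas_certificate :: "real lin_system \<Rightarrow> rat vec \<Rightarrow> bool" where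
  "farkas_certificate S lam \<longleftrightarrow>
     lam \<in> carrier_vec (dim_vec (snd S)) \<and>
     0\<^sub>v (dim_vec (snd S)) \<le> lam \<and>
     transpose_mat (fst S) *\<^sub>v map_vec of_rat lam = 0\<^sub>v (dim_col (fst S)) \<and>
     map_vec of_rat lam \<bullet> snd S < 0"


section \<open>Safety, stores and leaf certificates\<close>

definition encodes_unsafe :: "network \<Rightarrow> (real vec \<Rightarrow> bool) \<Rightarrow> real lin_system \<Rightarrow> bool" where
  "encodes_unsafe net safety \<Phi> \<longleftrightarrow>
     is_system (width net (depth net)) \<Phi> \<and>
     (\<forall>y\<in>carrier_vec (width net (depth net)).
        \<not> safety y \<longleftrightarrow> y \<in> Feas (width net (depth net)) \<Phi>)"

text \<open>A system on the output, regarded as a system on all network variables: the output is the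
  last block, and all other variables get coefficient 0.\<close>

definition lift_output_system :: "network \<Rightarrow> real lin_system \<Rightarrow> real lin_system" where
  "lift_output_system net \<Phi> =
     (mat (dim_row (fst \<Phi>)) (num_vars net)
        (\<lambda>(r, j). if z_offset net (depth net) \<le> j
                  then fst \<Phi> $$ (r, j - z_offset net (depth net)) else 0),
      snd \<Phi>)"

definition sound_store :: "network \<Rightarrow> real vec set \<Rightarrow> rat lin_system \<Rightarrow> bool" where
  "sound_store net R C \<longleftrightarrow>
     is_system (num_vars net) C \<and> Exact net R \<subseteq> Feas (num_vars net) (real_system C)"

definition safety_margin ::
    "network \<Rightarrow> (real vec \<Rightarrow> bool) \<Rightarrow> real vec \<Rightarrow> real \<Rightarrow> bool" where
  "safety_margin net safety q c \<longleftrightarrow> q \<in> carrier_vec (num_vars net) \<and>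
     (\<forall>v\<in>carrier_vec (num_vars net). 0 \<le> q \<bullet> v + c \<longrightarrow> safety (z_block net (depth net) v))"

text \<open>\<open>Dual_Bound q c lam\<close> certifies \<open>q \<bullet> v + c \<ge> 0\<close>, that is, \<open>- q \<bullet> v \<le> c\<close>.\<close>

datatype certificate =
    Dual_Bound "real vec" real "rat vec"
  | Farkas "rat vec"

fun valid_certificate ::
    "network \<Rightarrow> (real vec \<Rightarrow> bool) \<Rightarrow> real lin_system \<Rightarrow> rat lin_system \<Rightarrow> certificate \<Rightarrow> bool"
where
  "valid_certificate net safety \<Phi> C (Dual_Bound q c lam) \<longleftrightarrow>
     safety_margin net safety q c \<and> dual_bound_certificate (real_system C) (- q) c lam"
| "valid_certificate net safety \<Phi> C (Farkas lam) \<longleftrightarrow>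
     farkas_certificate (union_system (real_system C) (lift_output_system net \<Phi>)) lam"


section \<open>Partition trees\<close>

datatype partition_tree =
    Leaf "real vec set" "rat lin_system" certificate
  | Split "real vec set" "partition_tree list"

fun region :: "partition_tree \<Rightarrow> real vec set" where
  "region (Leaf R C cert) = R"
| "region (Split R ts) = R"

fun leaves :: "partition_tree \<Rightarrow> (real vec set \<times> rat lin_system \<times> certificate) set" where
  "leaves (Leaf R C cert) = {(R, C, cert)}"
| "leaves (Split R ts) = (\<Union>t\<in>set ts. leaves t)"

text \<open>Children are pairwise disjoint and cover their parent; unlike in \<open>partition_on\<close>, a child
  region may be empty, as happens when a split has an infeasible branch.\<close>

fun valid_splits :: "partition_tree \<Rightarrow> bool" where
  "valid_splits (Leaf R C cert) \<longleftrightarrow> True"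
| "valid_splits (Split R ts) \<longleftrightarrow>
     ts \<noteq> [] \<and>
     R = (\<Union>t\<in>set ts. region t) \<and>
     disjoint_family_on (\<lambda>i. region (ts ! i)) {..<length ts} \<and>
     (\<forall>t\<in>set ts. valid_splits t)"

end

theory Submission
  imports Defs
begin

text \<open>Running the network on an input \<open>x\<close> and recording all intermediate values yields a point
  of \<open>Exact R\<close> for the leaf region \<open>R\<close> containing \<open>x\<close>, hence a feasible point of the leaf store.
  By weak duality, a dual-bound certificate forces the safety margin to be nonnegative at this
  point. If the output were unsafe, the point would also satisfy the lifted query, which a Farkas
  certificate excludes by weak duality.\<close>

section \<open>Weak duality and soundness of certificates\<close>

text \<open>Transposition moves \<open>A\<close> onto \<open>v\<close>; each row of
  \<open>A v \<le> b\<close> is then scaled by a nonnegative multiplier, and the rows are added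
  up.\<close>

lemma weak_duality:
  fixes A :: "real mat" and b v lam :: "real vec"
  assumes A: "A \<in> carrier_mat (dim_vec b) n" and v: "v \<in> carrier_vec n"
    and lam: "0\<^sub>v (dim_vec b) \<le> lam" and Av: "A *\<^sub>v v \<le> b"
  shows "(transpose_mat A *\<^sub>v lam) \<bullet> v \<le> lam \<bullet> b"
proof -
  \<comment> \<open>The order on vectors includes equality of dimensions, so the sign condition also
    fixes the length of \<open>lam\<close>.\<close>
  have dim: "dim_vec lam = dim_vec b"
    using lam by (simp add: less_eq_vec_def)
  have nonneg: "\<And>i. i < dim_vec b \<Longrightarrow> 0 \<le> lam $ i"
    using lam dim by (auto simp: less_eq_vec_def)
  have le: "\<And>i. i < dim_vec b \<Longrightarrow> (A *\<^sub>v v) $ i \<le> b $ i"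
    using Av by (auto simp: less_eq_vec_def)
  have "(transpose_mat A *\<^sub>v lam) \<bullet> v = lam \<bullet> (A *\<^sub>v v)"
    using dim by (intro transpose_vec_mult_scalar[OF A v] carrier_vecI)
  also have "\<dots> = (\<Sum>i = 0..<dim_vec b. lam $ i * (A *\<^sub>v v) $ i)"
    using A by (simp add: scalar_prod_def)
  also have "\<dots> \<le> lam \<bullet> b"
    unfolding scalar_prod_def by (intro sum_mono mult_left_mono nonneg le) simp_all
  finally show ?thesis .
qed

text \<open>Certificates carry rational multipliers while weak duality is stated over the reals;
  this transfers the sign condition.\<close>

lemma of_rat_vec_nonneg:
  assumes "0\<^sub>v n \<le> lam"
  shows "0\<^sub>v n \<le> (map_vec of_rat lam :: real vec)"
  using assms by (auto simp: less_eq_vec_def)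

lemma dual_bound_certificate_sound:
  fixes g v :: "real vec"
  assumes "is_system n S" "v \<in> Feas n S" "dual_bound_certificate S g \<beta> lam"
  shows "g \<bullet> v \<le> \<beta>"
  using weak_duality[of "fst S" "snd S" n v "map_vec of_rat lam"] assms
  by (auto simp: is_system_def Feas_def dual_bound_certificate_def of_rat_vec_nonneg)

text \<open>The multipliers cancel the left-hand sides, so at a feasible point weak duality would
  make the combined right-hand side nonnegative, but it is negative.\<close>

lemma farkas_certificate_sound:
  assumes "is_system n S" "farkas_certificate S lam"
  shows "Feas n S = {}"
proof -
  have False if v: "v \<in> Feas n S" for v
    using weak_duality[of "fst S" "snd S" n v "map_vec of_rat lam"] assms v
    by (auto simp: is_system_def Feas_def farkas_certificate_def of_rat_vec_nonneg)
  then show ?thesis by blast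
qed

section \<open>Unions of linear systems\<close>

lemma is_system_real_system: "is_system n C \<Longrightarrow> is_system n (real_system C)"
  by (auto simp: is_system_def real_system_def)

lemma is_system_union_system:
  assumes "is_system n S" "is_system n T"
  shows "is_system n (union_system S T)"
  using assms by (auto simp: is_system_def union_system_def)

lemma Feas_union_system:
  assumes "is_system n S" "is_system n T" "v \<in> Feas n S" "v \<in> Feas n T"
  shows "v \<in> Feas n (union_system S T)"
proof -
  have "(fst S @\<^sub>r fst T) *\<^sub>v v \<le> snd S @\<^sub>v snd T"
    using assms unfolding is_system_def Feas_def by (subst append_rows_le) auto
  with assms(3) show ?thesis by (simp add: Feas_def union_system_def)
qed

section \<open>Layout of the variable blocks\<close>

lemma s_offset_Suc: "1 \<le> i \<Longrightarrow> s_offset net (Suc i) = s_offset net i + 2 * width net i"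
  by (simp add: s_offset_def)

text \<open>Treats the input layer, which has no pre-activation block, like the others; at
  \<open>i = depth net\<close> it yields the number of variables.\<close>

lemma s_offset_Suc_eq: "s_offset net (Suc i) = z_offset net i + width net i"
  by (cases "i = 0") (simp_all add: z_offset_def s_offset_Suc, simp add: s_offset_def)

lemma s_offset_mono: "i \<le> j \<Longrightarrow> s_offset net i \<le> s_offset net j"
  unfolding s_offset_def by (intro add_left_mono sum_mono2) auto

lemma num_vars_eq: "num_vars net = z_offset net (depth net) + width net (depth net)"
  by (simp flip: s_offset_Suc_eq add: num_vars_def s_offset_def atLeastLessThanSuc_atLeastAtMost)

section \<open>Lifting output constraints to all variables\<close>

lemma is_system_lift:
  "is_system (width net (depth net)) \<Phi> \<Longrightarrow>
     is_system (num_vars net) (lift_output_system net \<Phi>)"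
  by (auto simp: is_system_def lift_output_system_def)

text \<open>All columns before the output block are zero, so splitting each row sum at the offset of
  that block leaves only the output terms.\<close>

lemma lift_mult_vec:
  assumes "fst \<Phi> \<in> carrier_mat m (width net (depth net))" "v \<in> carrier_vec (num_vars net)"
  shows "fst (lift_output_system net \<Phi>) *\<^sub>v v = fst \<Phi> *\<^sub>v z_block net (depth net) v"
proof (rule eq_vecI)
  let ?o = "z_offset net (depth net)" and ?w = "width net (depth net)"
  fix r assume "r < dim_vec (fst \<Phi> *\<^sub>v z_block net (depth net) v)"
  then have r: "r < dim_row (fst \<Phi>)" by simp
  have split: "(\<Sum>j<a + n. f j) = (\<Sum>j<a. f j) + (\<Sum>j<n. f (a + j))" for f :: "nat \<Rightarrow> real" and a n
    by (induction n) simp_all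
  define f where "f j = (if ?o \<le> j then fst \<Phi> $$ (r, j - ?o) else 0) * v $ j" for j
  \<comment> \<open>The output block comes last, so the row sum ends exactly with it.\<close>
  have "(fst (lift_output_system net \<Phi>) *\<^sub>v v) $ r = (\<Sum>j<?o + ?w. f j)"
    using r assms(2)
    by (auto simp: lift_output_system_def scalar_prod_def f_def num_vars_eq atLeast0LessThan
        intro!: sum.cong)
  also have "\<dots> = (\<Sum>j<?o. f j) + (\<Sum>j<?w. f (?o + j))"
    by (rule split)
  also have "(\<Sum>j<?o. f j) = 0"
    by (simp add: f_def)
  also have "(\<Sum>j<?w. f (?o + j)) = (fst \<Phi> *\<^sub>v z_block net (depth net) v) $ r"
    using r assms(1)
    by (auto simp: scalar_prod_def f_def z_block_def atLeast0LessThan intro!: sum.cong)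
  finally show "(fst (lift_output_system net \<Phi>) *\<^sub>v v) $ r =
      (fst \<Phi> *\<^sub>v z_block net (depth net) v) $ r" by simp
qed (simp add: lift_output_system_def)

lemma Feas_lift_output_system:
  assumes "is_system (width net (depth net)) \<Phi>" "v \<in> carrier_vec (num_vars net)"
    and "z_block net (depth net) v \<in> Feas (width net (depth net)) \<Phi>"
  shows "v \<in> Feas (num_vars net) (lift_output_system net \<Phi>)"
proof -
  have "fst (lift_output_system net \<Phi>) *\<^sub>v v \<le> snd (lift_output_system net \<Phi>)"
    using assms lift_mult_vec[of \<Phi> "dim_vec (snd \<Phi>)" net v]
    by (simp add: is_system_def Feas_def) (simp add: lift_output_system_def)
  with assms(2) show ?thesis by (simp add: Feas_def)
qed

section \<open>The execution trace as a point of \<open>Exact\<close>\<close>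

text \<open>Blocks are appended in the order of the variable layout, so that the trace up to a layer
  is a prefix of every later trace.\<close>

primrec network_trace :: "network \<Rightarrow> real vec \<Rightarrow> nat \<Rightarrow> real vec" where
  "network_trace net x 0 = x"
| "network_trace net x (Suc i) = network_trace net x i @\<^sub>v
     ((weight net (Suc i) *\<^sub>v layer_value net x i + bias net (Suc i)) @\<^sub>v
      layer_value net x (Suc i))"

context
  fixes net :: network and x :: "real vec"
  assumes ff: "feedforward net" and x: "x \<in> carrier_vec (width net 0)"
begin

lemma preactivation_carrier:
  assumes "Suc i \<le> depth net"
  shows "weight net (Suc i) *\<^sub>v layer_value net x i + bias net (Suc i)
    \<in> carrier_vec (width net (Suc i))"
proof -
  have "bias net (Suc i) \<in> carrier_vec (width net (Suc i))"
    using ff assms unfolding feedforward_def by simp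
  \<comment> \<open>A vector sum takes its dimension from the second summand, here the bias.\<close>
  then show ?thesis by (intro carrier_vecI) simp
qed

lemma layer_value_carrier:
  assumes "i \<le> depth net"
  shows "layer_value net x i \<in> carrier_vec (width net i)"
proof (cases i)
  case (Suc j)
  with assms have "Suc j \<le> depth net" by simp
  from preactivation_carrier[OF this] show ?thesis
    unfolding Suc layer_value.simps activation_def by (cases "Suc j < depth net") simp_all
qed (simp add: x)

lemma dim_trace: "i \<le> depth net \<Longrightarrow> dim_vec (network_trace net x i) = s_offset net (Suc i)"
proof (induction i)
  case 0
  show ?case using carrier_vecD[OF x] by (simp add: s_offset_def)
next
  case (Suc i)
  have "dim_vec (network_trace net x (Suc i)) = dim_vec (network_trace net x i) +
      (dim_vec (weight net (Suc i) *\<^sub>v layer_value net x i + bias net (Suc i)) +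
       dim_vec (layer_value net x (Suc i)))"
    by (simp only: network_trace.simps index_append_vec)
  also have "\<dots> = s_offset net (Suc i) + 2 * width net (Suc i)"
    using Suc.IH[OF Suc_leD[OF Suc.prems]] carrier_vecD[OF preactivation_carrier[OF Suc.prems]]
      carrier_vecD[OF layer_value_carrier[OF Suc.prems]]
    by (simp only: mult_2)
  also have "\<dots> = s_offset net (Suc (Suc i))"
    by (simp add: s_offset_Suc)
  finally show ?case .
qed

text \<open>Lets an entry of the full trace be read in the shorter trace that ends with the layer of
  that entry.\<close>

lemma trace_prefix:
  assumes "i \<le> m" "m \<le> depth net" "k < s_offset net (Suc i)"
  shows "network_trace net x m $ k = network_trace net x i $ k"
  using assms
proof (induction m rule: dec_induct)
  case (step n)
  then have "s_offset net (Suc i) \<le> s_offset net (Suc n)"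
    by (intro s_offset_mono) simp
  with step have "k < dim_vec (network_trace net x n)" by (simp add: dim_trace)
  then have "network_trace net x (Suc n) $ k = network_trace net x n $ k"
    by (simp only: network_trace.simps index_append_vec trans_less_add1 if_True)
  also have "\<dots> = network_trace net x i $ k"
    using step.prems by (intro step.IH) simp_all
  finally show ?case .
qed simp

text \<open>In the trace that ends with layer \<open>i\<close>, the layer value is the final
  segment, and \<open>trace_prefix\<close> reduces the full trace to this one.\<close>

lemma z_block_trace:
  assumes "i \<le> depth net"
  shows "z_block net i (network_trace net x (depth net)) = layer_value net x i"
proof (rule eq_vecI)
  have lv: "dim_vec (layer_value net x i) = width net i"
    using layer_value_carrier[OF assms] by simp
  then show "dim_vec (z_block net i (network_trace net x (depth net))) = dim_vec (layer_value net x i)"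
    by (simp add: z_block_def)
  fix k assume "k < dim_vec (layer_value net x i)"
  with lv have k: "k < width net i" by simp
  have "network_trace net x (depth net) $ (z_offset net i + k) = network_trace net x i $ (z_offset net i + k)"
    using assms k by (intro trace_prefix) (simp_all add: s_offset_Suc_eq)
  also have "\<dots> = layer_value net x i $ k"
  proof (cases i)
    case 0
    then show ?thesis by (simp add: z_offset_def)
  next
    case (Suc j)
    define s where "s = weight net (Suc j) *\<^sub>v layer_value net x j + bias net (Suc j)"
    have "network_trace net x i = network_trace net x j @\<^sub>v (s @\<^sub>v layer_value net x i)"
      by (simp add: Suc s_def)
    moreover have "dim_vec (network_trace net x j) = s_offset net i"
      using dim_trace[of j] assms Suc by simp
    moreover have "dim_vec s = width net i"
      using preactivation_carrier[of j] assms Suc unfolding s_def by (simp only: carrier_vecD)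
    ultimately show ?thesis
      using k lv Suc by (simp add: z_offset_def)
  qed
  finally show "z_block net i (network_trace net x (depth net)) $ k = layer_value net x i $ k"
    using k by (simp add: z_block_def)
qed

text \<open>As for the \<open>z\<close> blocks, except that the pre-activation is the middle
  segment: after the earlier layers and before the value of its own layer.\<close>

lemma s_block_trace:
  assumes "Suc i \<le> depth net"
  shows "s_block net (Suc i) (network_trace net x (depth net)) =
    weight net (Suc i) *\<^sub>v layer_value net x i + bias net (Suc i)" (is "_ = ?s")
proof (rule eq_vecI)
  have s: "dim_vec ?s = width net (Suc i)"
    using preactivation_carrier[OF assms] by (simp only: carrier_vecD)
  then show "dim_vec (s_block net (Suc i) (network_trace net x (depth net))) = dim_vec ?s"
    by (simp add: s_block_def)
  fix k assume "k < dim_vec ?s"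
  with s have k: "k < width net (Suc i)" by simp
  have "network_trace net x (depth net) $ (s_offset net (Suc i) + k) =
      network_trace net x (Suc i) $ (s_offset net (Suc i) + k)"
    using assms k by (intro trace_prefix) (simp_all add: s_offset_Suc[of "Suc i"])
  also have "\<dots> = ?s $ k"
  proof -
    have "network_trace net x (Suc i) = network_trace net x i @\<^sub>v (?s @\<^sub>v layer_value net x (Suc i))"
      by simp
    moreover have "dim_vec (network_trace net x i) = s_offset net (Suc i)"
      using assms by (simp add: dim_trace)
    moreover have "dim_vec (layer_value net x (Suc i)) = width net (Suc i)"
      using layer_value_carrier[OF assms] by simp
    ultimately show ?thesis
      using k s by (simp only: index_append_vec) simp
  qed
  finally show "s_block net (Suc i) (network_trace net x (depth net)) $ k = ?s $ k"
    using k by (simp add: s_block_def)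
qed

text \<open>Once the blocks are identified, the network equations become the recursion that defines
  \<open>layer_value\<close>.\<close>

lemma trace_Exact:
  assumes "x \<in> R"
  shows "network_trace net x (depth net) \<in> Exact net R"
proof -
  have "s_block net i v = weight net i *\<^sub>v z_block net (i - 1) v + bias net i \<and>
      z_block net i v = activation net i (s_block net i v)"
    if "v = network_trace net x (depth net)" "i \<in> {1..depth net}" for i v
    using that by (cases i) (simp_all add: z_block_trace s_block_trace)
  moreover have "network_trace net x (depth net) \<in> carrier_vec (num_vars net)"
    by (rule carrier_vecI) (simp add: dim_trace s_offset_Suc_eq num_vars_eq)
  ultimately show ?thesis
    using assms z_block_trace[of 0] by (simp add: Exact_def)
qed

end

section \<open>From single leaves to the whole domain\<close>

lemma safe_leaf:
  assumes "feedforward net" "x \<in> carrier_vec (width net 0)" "x \<in> R"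
    and enc: "encodes_unsafe net safety \<Phi>" and store: "sound_store net R C"
    and cert: "valid_certificate net safety \<Phi> C cert"
  shows "safety (net_eval net x)"
proof -
  define v where "v = network_trace net x (depth net)"
  have out: "z_block net (depth net) v = net_eval net x"
    using assms by (simp add: v_def net_eval_def z_block_trace)
  have "v \<in> Exact net R"
    unfolding v_def using assms by (intro trace_Exact)
  with store have sys: "is_system (num_vars net) (real_system C)"
    and v: "v \<in> Feas (num_vars net) (real_system C)"
    by (auto simp: sound_store_def is_system_real_system)
  from v have vc: "v \<in> carrier_vec (num_vars net)" by (simp add: Feas_def)
  show ?thesis
  proof (cases cert)
    case (Dual_Bound q c lam)
    with cert have q: "safety_margin net safety q c"
      and d: "dual_bound_certificate (real_system C) (- q) c lam" by auto
    have "- q \<bullet> v \<le> c"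
      by (rule dual_bound_certificate_sound[OF sys v d])
    \<comment> \<open>Pulling out the sign turns the certified bound into a nonnegative margin at
      \<open>v\<close>.\<close>
    moreover have "- q \<bullet> v = - (q \<bullet> v)"
      using q vc by (auto simp: safety_margin_def)
    ultimately show ?thesis
      using q vc out by (auto simp: safety_margin_def)
  next
    case (Farkas lam)
    have \<Phi>: "is_system (width net (depth net)) \<Phi>"
      using enc by (simp add: encodes_unsafe_def)
    note lift = is_system_lift[OF \<Phi>]
    have "Feas (num_vars net) (union_system (real_system C) (lift_output_system net \<Phi>)) = {}"
      using cert Farkas
      by (intro farkas_certificate_sound[of _ _ lam] is_system_union_system sys lift) simp
    \<comment> \<open>Since \<open>v\<close> satisfies the store, the infeasibility of the union
      must come from the lifted query at \<open>v\<close>.\<close>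
    then have "v \<notin> Feas (num_vars net) (lift_output_system net \<Phi>)"
      using Feas_union_system[OF sys lift v] by blast
    \<comment> \<open>The output block of \<open>v\<close> is the network output, so the violation
      descends to \<open>\<Phi>\<close>, which describes exactly the unsafe outputs.\<close>
    then have "net_eval net x \<notin> Feas (width net (depth net)) \<Phi>"
      using Feas_lift_output_system[OF \<Phi> vc] out by auto
    moreover have "net_eval net x \<in> carrier_vec (width net (depth net))"
      using assms by (simp add: net_eval_def layer_value_carrier)
    ultimately show ?thesis
      using enc by (auto simp: encodes_unsafe_def)
  qed
qed

text \<open>The children of a split cover it, so \<open>x\<close> can be followed from the root into
  some child, down to a leaf.\<close>

lemma region_covered_by_leaves:
  assumes "valid_splits T" "x \<in> region T"
  shows "\<exists>(R, C, cert) \<in> leaves T. x \<in> R"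
  using assms
proof (induction T)
  case (Split R ts)
  then obtain t where "t \<in> set ts" "x \<in> region t" by auto
  with Split show ?case by fastforce
qed auto

theorem theorem7p3:
  fixes net :: network
    and D :: "real vec set"
    and safety :: "real vec \<Rightarrow> bool"
    and \<Phi> :: "real lin_system"
    and T :: partition_tree
  assumes "feedforward net"
    and "compact_domain (width net 0) D"
    and "encodes_unsafe net safety \<Phi>"
    and "region T = D"
    and "valid_splits T"
    and "\<And>R C cert. (R, C, cert) \<in> leaves T \<Longrightarrow> sound_store net R C"
    and "\<And>R C cert. (R, C, cert) \<in> leaves T \<Longrightarrow> valid_certificate net safety \<Phi> C cert"
  shows "\<forall>x\<in>D. safety (net_eval net x)"
proof
  fix x assume "x \<in> D"
  then obtain R C cert where leaf: "(R, C, cert) \<in> leaves T" and "x \<in> R"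
    using region_covered_by_leaves[OF assms(5)] assms(4) by fastforce
  \<comment> \<open>The domain condition also fixes the dimension of the inputs, on which the block
    layout of the trace relies.\<close>
  moreover have "x \<in> carrier_vec (width net 0)"
    using \<open>x \<in> D\<close> assms(2) by (auto simp: compact_domain_def)
  ultimately show "safety (net_eval net x)"
    using safe_leaf[OF assms(1) _ _ assms(3) assms(6,7)[OF leaf]] by blast
qed

end
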